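(* Let $K$ be a compact set in the strip $1/2<\sigma<1$ with connected complement, and let $g(s)$ be a continuous function on $K$ that is analytic in the interior of $K$. Suppose $\alpha\in(0,1)$ is an algebraic irrational number and $\{\alpha_n\}\subset(0,1]\cap\mathbb{Q}$ converges to $\alpha$. If for every sufficiently small $\varepsilon>0$ \[ \liminf_{T\to\infty}\limsup_{n\to\infty}\frac1T\,\mathrm{meas}\Big\{\tau\in[T,2T] : \sup_{s\in K}|\zeta(s+i\tau,\alpha_n)-g(s)|<\varepsilon\Big\}\ge c(\varepsilon)>0, \] then for every sufficiently small $\varepsilon>0$ \[ \liminf_{T\to\infty}\frac1T\,\mathrm{meas}\Big\{\tau\in[T,2T] : \sup_{s\in K}|\zeta(s+i\tau,\alpha)-g(s)|<\varepsilon\Big\}>0. \]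
   Context: For $0<\alpha\le1$, the Hurwitz zeta-function is $\zeta(s,\alpha)=\sum_{n=0}^\infty(n+\alpha)^{-s}$ for $\sigma>1$, continued meromorphically to $\mathbb{C}$. $\mathrm{meas}$ is one-dimensional Lebesgue measure; $c(\varepsilon)$ is some positive quantity depending on $\varepsilon$. *)

theory Defs
  imports "HOL-Complex_Analysis.Complex_Analysis"
begin

(* For a > 0 the series determines the continuation up to its values at removable singularities
   and poles; nicely_meromorphic_on normalises these, so the description is a unique one.
   In particular the value at the pole s = 1 is 0. *)
definition hurwitz_zeta :: "complex \<Rightarrow> real \<Rightarrow> complex" where
  "hurwitz_zeta s a = (THE f. f nicely_meromorphic_on UNIV \<and>
     (\<forall>z. Re z > 1 \<longrightarrow> f z = (\<Sum>n. (of_nat n + of_real a) powr (- z)))) s"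

definition approx_shifts ::
    "complex set \<Rightarrow> (complex \<Rightarrow> complex) \<Rightarrow> real \<Rightarrow> real \<Rightarrow> real \<Rightarrow> real set" where
  "approx_shifts K g a \<epsilon> T =
     {\<tau> \<in> {T..2*T}. (SUP s\<in>K. norm (hurwitz_zeta (s + \<i> * of_real \<tau>) a - g s)) < \<epsilon>}"

end

theory Submission
  imports Defs
begin

text \<open>
  For a fixed \<open>T\<close>, the functions \<open>s \<mapsto> \<zeta>(s + i\<tau>, \<alpha>\<^sub>n)\<close> tend to \<open>\<zeta>(s + i\<tau>, \<alpha>)\<close> uniformly for
  \<open>s \<in> K\<close> and \<open>\<tau> \<in> [T, 2T]\<close>, so for large \<open>n\<close> every shift that is \<open>\<epsilon>\<close>-good for \<open>\<alpha>\<^sub>n\<close> is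
  \<open>2\<epsilon>\<close>-good for \<open>\<alpha>\<close>. As the upper limit in \<open>n\<close> is taken before the lower limit in \<open>T\<close>, this
  suffices.

  The continuation to the whole plane, jointly continuous in \<open>(s, a)\<close>, comes from the recursion
  \<open>H(s, a) = a\<^bsup>1-s\<^esup> + (s - 1) \<integral>\<^sub>0\<^sup>1 (1 - v) H(s + 1, a + v) dv\<close> for \<open>H(s, a) = (s - 1) \<zeta>(s, a)\<close>,
  each use of which extends the domain by one unit to the left.
\<close>

section \<open>Holomorphy of integrals depending on a complex parameter\<close>

text \<open>Morera's theorem: by Fubini, the integral of \<open>?G\<close> around a triangle is an
  integral over \<open>t\<close> of triangle integrals of \<open>f z t\<close>, and each of these
  vanishes by Cauchy's theorem.\<close>

lemma holomorphic_integral_param: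
  fixes f :: "complex \<Rightarrow> real \<Rightarrow> complex"
  assumes "open S" and cont: "continuous_on (S \<times> cbox a b) (\<lambda>(z, t). f z t)"
    and hol: "\<And>t. t \<in> cbox a b \<Longrightarrow> (\<lambda>z. f z t) holomorphic_on S"
  shows "(\<lambda>z. integral (cbox a b) (f z)) holomorphic_on S"
proof -
  let ?G = "\<lambda>z. integral (cbox a b) (f z)"
  have swap: "contour_integral (linepath p q) ?G
      = integral (cbox a b) (\<lambda>t. contour_integral (linepath p q) (\<lambda>z. f z t))"
    and int: "(\<lambda>t. contour_integral (linepath p q) (\<lambda>z. f z t)) integrable_on cbox a b"
    if "closed_segment p q \<subseteq> S" for p q
  proof -
    have lp: "linepath p q x \<in> S" if "x \<in> {0..1}" for x
      using \<open>closed_segment p q \<subseteq> S\<close> that linepath_in_path by blast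
    have c: "continuous_on (cbox 0 1 \<times> cbox a b) (\<lambda>(x, t). f (linepath p q x) t * (q - p))"
    proof -
      have "continuous_on (cbox 0 1 \<times> cbox a b) (\<lambda>w. (\<lambda>(z, t). f z t) (linepath p q (fst w), snd w))"
        by (rule continuous_on_compose2[OF cont])
           (auto intro!: continuous_intros continuous_on_linepath lp[unfolded linepath_def] simp: linepath_def)
      then show ?thesis
        by (auto intro!: continuous_intros simp: case_prod_beta)
    qed
    have c': "continuous_on (cbox a b \<times> cbox 0 1) (\<lambda>(t, x). f (linepath p q x) t * (q - p))"
    proof -
      have "continuous_on (cbox a b \<times> cbox 0 1)
          (\<lambda>w. (\<lambda>(x, t). f (linepath p q x) t * (q - p)) (snd w, fst w))"
        by (rule continuous_on_compose2[OF c]) (auto intro!: continuous_intros)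
      then show ?thesis
        by (simp add: case_prod_beta)
    qed
    have eq: "contour_integral (linepath p q) h = integral (cbox 0 1) (\<lambda>x. h (linepath p q x) * (q - p))" for h
      by (simp add: contour_integral_integral)
    show "(\<lambda>t. contour_integral (linepath p q) (\<lambda>z. f z t)) integrable_on cbox a b"
      unfolding eq by (rule integrable_continuous, rule integral_continuous_on_param[OF c'])
    have "contour_integral (linepath p q) ?G
        = integral (cbox 0 1) (\<lambda>x. integral (cbox a b) (\<lambda>t. f (linepath p q x) t * (q - p)))"
      unfolding eq by simp
    also have "\<dots> = integral (cbox a b) (\<lambda>t. integral (cbox 0 1) (\<lambda>x. f (linepath p q x) t * (q - p)))"
      by (rule integral_swap_continuous) (use c in \<open>simp add: cbox_Pair_eq\<close>)
    finally show "contour_integral (linepath p q) ?G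
        = integral (cbox a b) (\<lambda>t. contour_integral (linepath p q) (\<lambda>z. f z t))"
      unfolding eq .
  qed
  have "?G analytic_on S"
  proof (rule Morera_triangle)
    show "continuous_on S ?G"
      by (rule integral_continuous_on_param[OF cont])
    show "open S" by fact
  next
    fix p q r
    let ?T = "contour_integral (linepath p q) ?G + contour_integral (linepath q r) ?G + contour_integral (linepath r p) ?G"
    show "convex hull {p, q, r} \<subseteq> S \<longrightarrow> ?T = 0"
    proof
      assume sub: "convex hull {p, q, r} \<subseteq> S"
      have seg: "closed_segment p q \<subseteq> S" "closed_segment q r \<subseteq> S" "closed_segment r p \<subseteq> S"
        using sub hull_mono[of "{p, q}" "{p, q, r}" convex] hull_mono[of "{q, r}" "{p, q, r}" convex]
          hull_mono[of "{r, p}" "{p, q, r}" convex] by (auto simp: segment_convex_hull)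
      have "?T
         = integral (cbox a b) (\<lambda>t. contour_integral (linepath p q) (\<lambda>z. f z t)
             + contour_integral (linepath q r) (\<lambda>z. f z t) + contour_integral (linepath r p) (\<lambda>z. f z t))"
        by (simp only: swap seg integral_add int integrable_add)
      also have "\<dots> = integral (cbox a b) (\<lambda>t. 0)"
      proof (rule integral_cong)
        fix t assume t: "t \<in> cbox a b"
        have h: "(\<lambda>z. f z t) holomorphic_on convex hull {p, q, r}"
          using hol[OF t] sub holomorphic_on_subset by blast
        have ci: "(\<lambda>z. f z t) contour_integrable_on linepath x y" if "closed_segment x y \<subseteq> S" for x y
          by (rule contour_integrable_continuous_linepath)
             (use hol[OF t] that holomorphic_on_imp_continuous_on continuous_on_subset in blast)
        have "((\<lambda>z. f z t) has_contour_integral 0) (linepath p q +++ linepath q r +++ linepath r p)"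
          by (rule Cauchy_theorem_triangle[OF h])
        from contour_integral_unique[OF this]
        show "contour_integral (linepath p q) (\<lambda>z. f z t) + contour_integral (linepath q r) (\<lambda>z. f z t)
            + contour_integral (linepath r p) (\<lambda>z. f z t) = 0"
          using ci[OF seg(1)] ci[OF seg(2)] ci[OF seg(3)]
          by (simp add: contour_integrable_join add.assoc)
      qed
      finally show "?T = 0"
        by simp
    qed
  qed
  then show ?thesis
    by (rule analytic_imp_holomorphic)
qed

section \<open>The Hurwitz series in its half-plane of convergence\<close>

text \<open>Weierstrass M-test with majorant \<open>n powr (- \<delta>)\<close>. It applies from
  \<open>n = 1\<close> on; the term for \<open>n = 0\<close> is unbounded as \<open>a\<close> tends
  to 0, but one term does not affect uniform convergence. Uniformity in \<open>a\<close> later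
  allows termwise integration over \<open>a + v\<close>.\<close>

lemma hurwitz_series_uniform_limit:
  assumes "1 < \<delta>"
  shows "uniform_limit ({s. \<delta> \<le> Re s} \<times> {0<..})
    (\<lambda>N (s, a). \<Sum>n<N. (of_nat n + of_real a) powr (- s))
    (\<lambda>(s, a). \<Sum>n. (of_nat n + of_real a :: complex) powr (- s)) sequentially"
proof -
  have "norm ((of_nat n + of_real a) powr (- s)) \<le> real n powr (- \<delta>)"
    if "n \<ge> 1" "\<delta> \<le> Re s" "a > 0" for n a s
  proof -
    have "norm ((of_nat n + of_real a) powr (- s)) = (real n + a) powr (- Re s)"
      using that norm_powr_real_powr[of "of_nat n + of_real a" "- s"] by simp
    also have "\<dots> \<le> (real n + a) powr (- \<delta>)"
      using that by (intro powr_mono) auto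
    also have "\<dots> \<le> real n powr (- \<delta>)"
      using that assms by (intro powr_mono2') auto
    finally show ?thesis .
  qed
  moreover have "summable (\<lambda>n. real n powr (- \<delta>))"
    using assms by (simp add: summable_real_powr_iff)
  ultimately have "uniform_limit ({s. \<delta> \<le> Re s} \<times> {0<..})
    (\<lambda>N p. \<Sum>n<N. (of_nat n + of_real (snd p)) powr (- fst p))
    (\<lambda>p. \<Sum>n. (of_nat n + of_real (snd p) :: complex) powr (- fst p)) sequentially"
    by (intro Weierstrass_m_test_ev[where M = "\<lambda>n. real n powr (- \<delta>)"])
       (auto intro!: eventually_sequentiallyI[of 1])
  then show ?thesis
    by (simp add: case_prod_beta')
qed

lemma of_nat_add_of_real_neq_0:
  "a > 0 \<Longrightarrow> of_nat n + of_real a \<noteq> (0 :: complex)"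
  by (auto simp: complex_eq_iff)

lemma hurwitz_series_continuous_on:
  "continuous_on ({s. 1 < Re s} \<times> {0<..})
    (\<lambda>(s, a). \<Sum>n. (of_nat n + of_real a :: complex) powr (- s))"
proof -
  have "isCont (\<lambda>(s, a). \<Sum>n. (of_nat n + of_real a :: complex) powr (- s)) (s, a)"
    if s: "1 < Re s" and a: "0 < a" for s a
  proof -
    \<comment> \<open>The midpoint between 1 and \<open>Re s\<close>: the half-plane
      \<open>Re > \<delta>\<close> is a neighbourhood of \<open>s\<close> on which convergence is
      uniform.\<close>
    define \<delta> where "\<delta> = (1 + Re s) / 2"
    have \<delta>: "1 < \<delta>" "\<delta> < Re s" using s by (auto simp: \<delta>_def)
    let ?U = "{s. \<delta> < Re s} \<times> {0::real<..}"
    have "continuous_on ?U (\<lambda>(s, a). \<Sum>n. (of_nat n + of_real a :: complex) powr (- s))"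
    proof (rule uniform_limit_theorem)
      show "uniform_limit ?U (\<lambda>N (s, a). \<Sum>n<N. (of_nat n + of_real a) powr (- s))
        (\<lambda>(s, a). \<Sum>n. (of_nat n + of_real a :: complex) powr (- s)) sequentially"
        by (rule uniform_limit_on_subset[OF hurwitz_series_uniform_limit[OF \<delta>(1)]]) auto
      show "\<forall>\<^sub>F N in sequentially. continuous_on ?U
          (\<lambda>(s, a). \<Sum>n<N. (of_nat n + of_real a :: complex) powr (- s))"
        by (auto simp: case_prod_beta of_nat_add_of_real_neq_0 intro!: always_eventually continuous_intros)
    qed simp
    moreover have "open ?U"
      by (intro open_Times open_halfspace_Re_gt) auto
    ultimately show ?thesis
      using \<delta> a by (auto simp: continuous_on_eq_continuous_at)
  qed
  then show ?thesis
    by (auto intro!: continuous_at_imp_continuous_on)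
qed

lemma hurwitz_series_holomorphic_on:
  assumes "a > 0"
  shows "(\<lambda>s. \<Sum>n. (of_nat n + of_real a :: complex) powr (- s)) holomorphic_on {s. 1 < Re s}"
proof (rule holomorphic_uniform_sequence)
  show "open {s. 1 < Re s}" by (rule open_halfspace_Re_gt)
  show "(\<lambda>s. \<Sum>n<N. (of_nat n + of_real a :: complex) powr (- s)) holomorphic_on {s. 1 < Re s}" for N
    by (intro holomorphic_intros)
  fix s :: complex assume s: "s \<in> {s. 1 < Re s}"
  define d where "d = (Re s - 1) / 2"
  have d: "1 < Re s - d" "d > 0" using s by (auto simp: d_def field_simps)
  have *: "Re s - d \<le> Re z" if "z \<in> cball s d" for z
    using that abs_Re_le_cmod[of "s - z"] by (auto simp: dist_norm)
  have "uniform_limit (cball s d) (\<lambda>N z. \<Sum>n<N. (of_nat n + of_real a) powr (- z))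
    (\<lambda>z. \<Sum>n. (of_nat n + of_real a :: complex) powr (- z)) sequentially"
    using uniform_limit_compose'[OF hurwitz_series_uniform_limit[OF d(1)], of "\<lambda>z. (z, a)" "cball s d"]
      * assms by auto
  then show "\<exists>d>0. cball s d \<subseteq> {s. 1 < Re s} \<and>
      uniform_limit (cball s d) (\<lambda>N z. \<Sum>n<N. (of_nat n + of_real a) powr (- z))
        (\<lambda>z. \<Sum>n. (of_nat n + of_real a :: complex) powr (- z)) sequentially"
    using d * by (intro exI[of _ d]) force
qed

section \<open>Analytic continuation by the recursion\<close>

text \<open>
  On the half-plane \<open>Re s > 1 - k\<close>, \<open>hurwitz_cont k s a\<close> is \<open>(s - 1) \<zeta>(s, a)\<close>; further left it is junk.
\<close>
primrec hurwitz_cont :: "nat \<Rightarrow> complex \<Rightarrow> real \<Rightarrow> complex" where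
  "hurwitz_cont 0 s a = (s - 1) * (\<Sum>n. (of_nat n + of_real a) powr (- s))"
| "hurwitz_cont (Suc k) s a = of_real a powr (1 - s)
     + (s - 1) * integral (cbox 0 1) (\<lambda>v. of_real (1 - v) * hurwitz_cont k (s + 1) (a + v))"

text \<open>The shift by 1 carries the half-plane of level \<open>Suc k\<close> into that of level
  \<open>k\<close>, and \<open>a + v\<close> stays positive, so the induction hypothesis covers the
  integrand. Joint continuity is the right invariant because the integral runs through the second
  argument.\<close>

lemma hurwitz_cont_continuous_on:
  "continuous_on ({s. 1 - real k < Re s} \<times> {0<..}) (\<lambda>(s, a). hurwitz_cont k s a)"
proof (induction k)
  case 0
  show ?case
    using hurwitz_series_continuous_on by (auto simp: case_prod_beta intro!: continuous_intros)
next
  case (Suc k)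
  let ?U = "{s. 1 - real (Suc k) < Re s} \<times> {0<..}"
  have "continuous_on (?U \<times> cbox 0 1)
      (\<lambda>w. (\<lambda>(s, a). hurwitz_cont k s a) (fst (fst w) + 1, snd (fst w) + snd w))"
    by (rule continuous_on_compose2[OF Suc.IH]) (auto intro!: continuous_intros)
  then have "continuous_on (?U \<times> cbox 0 1)
      (\<lambda>(p, v). of_real (1 - v) * hurwitz_cont k (fst p + 1) (snd p + v))"
    by (auto simp: case_prod_beta intro!: continuous_intros)
  then have *: "continuous_on ?U
      (\<lambda>p. integral (cbox 0 1) (\<lambda>v. of_real (1 - v) * hurwitz_cont k (fst p + 1) (snd p + v)))"
    by (rule integral_continuous_on_param)
  show ?case
    unfolding hurwitz_cont.simps case_prod_beta
    by (intro continuous_intros *) auto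
qed

lemma hurwitz_cont_holomorphic_on:
  "a > 0 \<Longrightarrow> (\<lambda>s. hurwitz_cont k s a) holomorphic_on {s. 1 - real k < Re s}"
proof (induction k arbitrary: a)
  case 0
  then show ?case
    using hurwitz_series_holomorphic_on by (auto intro!: holomorphic_intros)
next
  case (Suc k)
  let ?S = "{s. 1 - real (Suc k) < Re s}"
  have hol: "(\<lambda>s. hurwitz_cont k (s + 1) (a + v)) holomorphic_on ?S" if "v \<in> cbox 0 1" for v
  proof -
    have "(\<lambda>s. hurwitz_cont k s (a + v)) holomorphic_on {s. 1 - real k < Re s}"
      using Suc that by auto
    then have "((\<lambda>s. hurwitz_cont k s (a + v)) \<circ> (\<lambda>s. s + 1)) holomorphic_on ?S"
      by (rule holomorphic_on_compose_gen[rotated]) (auto intro!: holomorphic_intros)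
    then show ?thesis
      by (simp add: o_def)
  qed
  have "continuous_on (?S \<times> cbox 0 1)
      (\<lambda>w. (\<lambda>(s, a). hurwitz_cont k s a) (fst w + 1, a + snd w))"
    using Suc.prems
    by (intro continuous_on_compose2[OF hurwitz_cont_continuous_on[of k]]) (auto intro!: continuous_intros)
  then have "continuous_on (?S \<times> cbox 0 1)
      (\<lambda>(s, v). of_real (1 - v) * hurwitz_cont k (s + 1) (a + v))"
    by (auto simp: case_prod_beta intro!: continuous_intros)
  then have *: "(\<lambda>s. integral (cbox 0 1) (\<lambda>v. of_real (1 - v) * hurwitz_cont k (s + 1) (a + v)))
      holomorphic_on ?S"
    using hol open_halfspace_Re_gt
    by (intro holomorphic_integral_param) (auto intro!: holomorphic_intros)
  show ?case
    unfolding hurwitz_cont.simps by (intro holomorphic_intros *) 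
qed

text \<open>
  Integrating by parts, the sum of these integrals over \<open>x = a, a + 1, \<dots>\<close> telescopes up to the
  Hurwitz series.
\<close>
lemma has_integral_hurwitz_term:
  fixes s :: complex and x :: real
  assumes "x > 0" "s \<noteq> 1"
  shows "((\<lambda>v. of_real (1 - v) * (s * of_real (x + v) powr (- (s + 1)))) has_integral
    (of_real x powr (- s) - (of_real (x + 1) powr (1 - s) - of_real x powr (1 - s)) / (1 - s))) (cbox 0 1)"
proof -
  \<comment> \<open>The antiderivative from integration by parts: on differentiating, the two terms
    \<open>(x + v) powr (- s)\<close> cancel. Its argument is complex, so that complex derivatives
    apply before restriction to real \<open>v\<close>.\<close>
  define F where "F = (\<lambda>v. - ((1 - v) * (of_real x + v) powr (- s)) - (of_real x + v) powr (1 - s) / (1 - s))"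
  have F: "(F has_field_derivative (1 - of_real v) * (s * (of_real x + of_real v) powr (- (s + 1))))
      (at (of_real v))" if "v \<ge> 0" for v :: real
  proof -
    have nr: "of_real x + of_real v \<notin> (\<real>\<^sub>\<le>\<^sub>0 :: complex set)" "of_real v + of_real x \<notin> (\<real>\<^sub>\<le>\<^sub>0 :: complex set)"
      using assms that by (auto simp: complex_nonpos_Reals_iff)
    then have "((\<lambda>v. (of_real x + v :: complex) powr p) has_field_derivative
        p * (of_real x + of_real v) powr (p - 1)) (at (of_real v))" for p
      by (auto intro!: derivative_eq_intros)
    note d = this[of "- s"] this[of "1 - s"]
    have e: "1 - s - 1 = - s" "- (s + 1) = - s - 1" by auto
    show ?thesis
      unfolding F_def using assms
      by (auto intro!: derivative_eq_intros d simp: e nr) (simp add: algebra_simps)?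
  qed
  have "((\<lambda>v. F (of_real v)) has_vector_derivative (1 - of_real v) * (s * (of_real x + of_real v) powr (- (s + 1))))
      (at v within {0..1})" if "v \<in> {0..1}" for v :: real
  proof -
    have "((\<lambda>v. of_real v :: complex) has_vector_derivative of_real 1) (at v within {0..1})"
      by (intro has_vector_derivative_of_real DERIV_ident)
    from field_vector_diff_chain_within[OF this has_field_derivative_at_within[OF F[of v]]] that
    show ?thesis
      by (simp add: o_def)
  qed
  then have "((\<lambda>v. (1 - of_real v) * (s * (of_real x + of_real v) powr (- (s + 1)))) has_integral
      (F (of_real 1) - F (of_real 0))) {0..1::real}"
    by (intro fundamental_theorem_of_calculus) auto
  then show ?thesis
    by (simp add: F_def diff_divide_distrib algebra_simps)
qed

lemma tendsto_of_real_powr_0: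
  assumes "Re s < 0"
  shows "(\<lambda>n. (of_nat n + of_real a :: complex) powr s) \<longlonglongrightarrow> 0"
proof -
  have "filterlim (\<lambda>n. a + real n) at_top sequentially"
    by (intro filterlim_tendsto_add_at_top[OF tendsto_const] filterlim_real_sequentially)
  then have lim: "(\<lambda>n. (a + real n) powr Re s) \<longlonglongrightarrow> 0"
    using assms by (intro tendsto_neg_powr)
  have "\<forall>\<^sub>F n in sequentially. (a + real n) powr Re s = norm ((of_nat n + of_real a :: complex) powr s)"
    using eventually_ge_at_top[of "nat \<lceil>\<bar>a\<bar>\<rceil>"]
  proof eventually_elim
    case (elim n)
    then have "real n + a \<ge> 0" by linarith
    then show ?case
      using norm_powr_real_powr[of "of_nat n + of_real a" s] by (simp add: add.commute)
  qed
  then show ?thesis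
    by (intro tendsto_norm_zero_cancel[OF Lim_transform_eventually[OF lim]])
qed

text \<open>Termwise integration of the series at \<open>s + 1\<close> and telescoping give
  \<open>J\<close>, the Hurwitz series plus \<open>a powr (1 - s) / (1 - s)\<close>. After
  multiplication by \<open>s - 1\<close>, the extra term cancels the leading
  \<open>a powr (1 - s)\<close> of the recursion.\<close>

lemma hurwitz_cont_1_eq_0:
  assumes s: "Re s > 1" and a: "a > 0"
  shows "hurwitz_cont 1 s a = hurwitz_cont 0 s a"
proof -
  let ?t = "\<lambda>n s a. (of_nat n + of_real a :: complex) powr (- s)"
  have [simp]: "s \<noteq> 1" using s by auto
  \<comment> \<open>The factor \<open>s\<close> is the prefactor \<open>(s + 1) - 1\<close> of
    \<open>hurwitz_cont 0 (s + 1)\<close>.\<close>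
  let ?f = "\<lambda>N v. of_real (1 - v) * (s * (\<Sum>n<N. ?t n (s + 1) (a + v)))"
  let ?g = "\<lambda>v. of_real (1 - v) * (s * (\<Sum>n. ?t n (s + 1) (a + v)))"
  have "uniform_limit ({z. Re (s + 1) \<le> Re z} \<times> {0<..})
    (\<lambda>N (s, a). \<Sum>n<N. ?t n s a) (\<lambda>(s, a). \<Sum>n. ?t n s a) sequentially"
    using s by (intro hurwitz_series_uniform_limit) auto
  from uniform_limit_compose'[OF this, of "\<lambda>v. (s + 1, a + v)" "cbox 0 1"]
  have lim: "uniform_limit (cbox 0 1) (\<lambda>N v. \<Sum>n<N. ?t n (s + 1) (a + v))
      (\<lambda>v. \<Sum>n. ?t n (s + 1) (a + v)) sequentially"
    using a by auto
  have ulim: "uniform_limit (cbox 0 1) ?f ?g sequentially"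
  proof (rule uniform_limitI)
    fix e :: real assume "e > 0"
    have "\<forall>\<^sub>F N in sequentially. \<forall>v\<in>cbox 0 1.
        dist (\<Sum>n<N. ?t n (s + 1) (a + v)) (\<Sum>n. ?t n (s + 1) (a + v)) < e / (norm s + 1)"
      \<comment> \<open>The divisor \<open>norm s + 1\<close> dominates the factor \<open>s\<close>
        and is positive; the weight \<open>1 - v\<close> is at most 1 in absolute value.\<close>
      by (rule uniform_limitD[OF lim]) (use \<open>e > 0\<close> in \<open>simp add: add_nonneg_pos\<close>)
    then show "\<forall>\<^sub>F N in sequentially. \<forall>v\<in>cbox 0 1. dist (?f N v) (?g v) < e"
    proof (rule eventually_mono, intro ballI)
      fix N v
      assume *: "\<forall>v\<in>cbox 0 1. dist (\<Sum>n<N. ?t n (s + 1) (a + v)) (\<Sum>n. ?t n (s + 1) (a + v)) < e / (norm s + 1)"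
        and v: "v \<in> cbox 0 (1::real)"
      let ?d = "dist (\<Sum>n<N. ?t n (s + 1) (a + v)) (\<Sum>n. ?t n (s + 1) (a + v))"
      have "dist (?f N v) (?g v) = \<bar>1 - v\<bar> * (norm s * ?d)"
        unfolding dist_norm right_diff_distrib[symmetric] norm_mult norm_of_real ..
      also have "\<dots> \<le> 1 * ((norm s + 1) * ?d)"
        using v by (intro mult_mono) auto
      also have "\<dots> < e"
        using bspec[OF * v] by (simp add: add_nonneg_pos pos_less_divide_eq mult.commute)
      finally show "dist (?f N v) (?g v) < e" .
    qed
  qed
  have cont: "continuous_on (cbox 0 1) (?f N)" for N
    using a of_nat_add_of_real_neq_0[of "a + v" n for v n]
    by (auto intro!: continuous_intros)
  obtain I J where I: "\<And>N. (?f N has_integral I N) (cbox 0 1)"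
    and J: "(?g has_integral J) (cbox 0 1)" and IJ: "I \<longlonglongrightarrow> J"
    using uniform_limit_integral_cbox[OF ulim cont] by auto
  \<comment> \<open>The boundary terms of \<open>has_integral_hurwitz_term\<close> at
    \<open>x = n + a\<close>; \<open>u\<close> tends to 0 because \<open>Re (1 - s) < 0\<close>, so
    only \<open>u 0\<close> survives.\<close>
  define u where "u = (\<lambda>n. (of_nat n + of_real a :: complex) powr (1 - s) / (1 - s))"
  have I_eq: "I = (\<lambda>N. (\<Sum>n<N. ?t n s a) - (u N - u 0))"
  proof
    fix N
    have "((\<lambda>v. of_real (1 - v) * (s * ?t n (s + 1) (a + v))) has_integral (?t n s a - (u (Suc n) - u n))) (cbox 0 1)" for n
      using has_integral_hurwitz_term[of "real n + a" s] a
      by (simp add: u_def add_ac diff_divide_distrib)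
    then have "((\<lambda>v. \<Sum>n<N. of_real (1 - v) * (s * ?t n (s + 1) (a + v))) has_integral
        (\<Sum>n<N. ?t n s a - (u (Suc n) - u n))) (cbox 0 1)"
      by (intro has_integral_sum) auto
    then have "(?f N has_integral (\<Sum>n<N. ?t n s a - (u (Suc n) - u n))) (cbox 0 1)"
      by (simp add: sum_distrib_left)
    then have "I N = (\<Sum>n<N. ?t n s a - (u (Suc n) - u n))"
      using I has_integral_unique by blast
    then show "I N = (\<Sum>n<N. ?t n s a) - (u N - u 0)"
      by (simp only: sum_subtractf[of "\<lambda>n. ?t n s a"] sum_lessThan_telescope)
  qed
  have "(\<lambda>N. \<Sum>n<N. ?t n s a) \<longlonglongrightarrow> (\<Sum>n. ?t n s a)"
    using tendsto_uniform_limitI[OF hurwitz_series_uniform_limit[OF s], of "(s, a)"] a by auto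
  moreover have "u \<longlonglongrightarrow> 0"
    unfolding u_def using tendsto_divide[OF tendsto_of_real_powr_0[of "1 - s" a] tendsto_const[of "1 - s"]] s
    by auto
  ultimately have "I \<longlonglongrightarrow> (\<Sum>n. ?t n s a) - (0 - u 0)"
    unfolding I_eq by (intro tendsto_diff tendsto_const)
  then have "J = (\<Sum>n. ?t n s a) - (0 - u 0)"
    by (rule LIMSEQ_unique[OF IJ])
  then have J': "J = (\<Sum>n. ?t n s a) + of_real a powr (1 - s) / (1 - s)"
    by (simp add: u_def)
  have "integral (cbox 0 1) (\<lambda>v. of_real (1 - v) * hurwitz_cont 0 (s + 1) (a + v)) = J"
    using integral_unique[OF J] unfolding hurwitz_cont.simps by simp
  then have "hurwitz_cont 1 s a = of_real a powr (1 - s) + (s - 1) * J"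
    unfolding One_nat_def hurwitz_cont.simps(2) by simp
  moreover have "(s - 1) * (w / (1 - s)) = - w" for w
    using \<open>s \<noteq> 1\<close> by (simp add: nonzero_divide_eq_eq divide_simps) (simp add: algebra_simps)
  ultimately have "hurwitz_cont 1 s a = (s - 1) * (\<Sum>n. ?t n s a)"
    unfolding J' distrib_left by simp
  then show ?thesis
    unfolding hurwitz_cont.simps(1) .
qed

text \<open>Consecutive positive levels differ only under the integral, at \<open>s + 1\<close> and
  \<open>a + v\<close>, so induction reduces agreement to the series identity at level 0.
  Generalising over \<open>a\<close> is essential for the shift.\<close>

lemma hurwitz_cont_Suc:
  "1 - real k < Re s \<Longrightarrow> a > 0 \<Longrightarrow> hurwitz_cont (Suc k) s a = hurwitz_cont k s a"
proof (induction k arbitrary: s a)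
  case 0
  then show ?case
    using hurwitz_cont_1_eq_0[of s a] by (simp del: hurwitz_cont.simps)
next
  case (Suc k)
  have "integral (cbox 0 1) (\<lambda>v. of_real (1 - v) * hurwitz_cont (Suc k) (s + 1) (a + v))
     = integral (cbox 0 1) (\<lambda>v. of_real (1 - v) * hurwitz_cont k (s + 1) (a + v))"
    using Suc.prems by (intro integral_cong arg_cong2[where f = "(*)"] Suc.IH) auto
  then show ?case
    by (simp only: hurwitz_cont.simps)
qed

lemma hurwitz_cont_eq:
  assumes "1 - real k < Re s" "k \<le> m" "a > 0"
  shows "hurwitz_cont m s a = hurwitz_cont k s a"
  using assms(2)
proof (induction m rule: dec_induct)
  case (step m)
  then show ?case
    using assms hurwitz_cont_Suc[of m s a] by simp
qed simp

section \<open>Uniqueness of the continuation and identification with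
  \<open>hurwitz_zeta\<close>\<close>

text \<open>This is the uniqueness behind the definite description. By the identity theorem
  \<open>f - g\<close> vanishes off a sparse set, so around each point both functions have the same
  limit or both have a pole; the normalisation then fixes the value.\<close>

lemma nicely_meromorphic_on_UNIV_eqI:
  assumes f: "f nicely_meromorphic_on UNIV" and g: "g nicely_meromorphic_on UNIV"
    and S: "open S" "z0 \<in> S" and eq: "\<And>z. z \<in> S \<Longrightarrow> f z = g z"
  shows "f = g"
proof
  fix z
  have "(\<lambda>z. f z - g z) meromorphic_on UNIV"
    using f g by (auto simp: nicely_meromorphic_on_def intro!: meromorphic_intros)
  then have "(\<forall>\<^sub>\<approx>z\<in>UNIV. f z - g z = 0) \<or> (\<forall>\<^sub>\<approx>z\<in>UNIV. f z - g z \<noteq> 0)"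
    by (rule meromorphic_imp_constant_or_avoid) auto
  moreover have "\<not> (\<forall>\<^sub>\<approx>z\<in>UNIV. f z - g z \<noteq> 0)"
  proof
    assume "\<forall>\<^sub>\<approx>z\<in>UNIV. f z - g z \<noteq> 0"
    then have "\<forall>\<^sub>F z in at z0. f z - g z \<noteq> 0"
      by (auto simp: eventually_cosparse_open_eq)
    moreover have "\<forall>\<^sub>F z in at z0. f z - g z = 0"
      using S eq by (auto simp: eventually_at_topological)
    ultimately have "\<forall>\<^sub>F z in at z0. False"
      by eventually_elim simp
    then show False
      by simp
  qed
  ultimately have ev: "\<forall>\<^sub>F w in at z. f w = g w"
    by (auto simp: eventually_cosparse_open_eq)
  show "f z = g z"
  proof (cases "is_pole f z")
    case True
    then have "is_pole g z"
      using is_pole_cong[OF ev refl] by simp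
    with True show ?thesis
      using is_pole_zero_at_nicely_mero f g by (metis UNIV_I)
  next
    case False
    then have "\<not> is_pole g z"
      using is_pole_cong[OF ev refl] by simp
    with False have "f \<midarrow>z\<rightarrow> f z" "g \<midarrow>z\<rightarrow> g z"
      using f g by (auto simp: nicely_meromorphic_on_def)
    moreover have "f \<midarrow>z\<rightarrow> g z \<longleftrightarrow> g \<midarrow>z\<rightarrow> g z"
      by (rule tendsto_cong[OF ev])
    ultimately show ?thesis
      using LIM_unique by blast
  qed
qed

text \<open>The levels glue to an entire function \<open>E\<close>, and \<open>E s / (s - 1)\<close>
  meets the description of the zeta-function, which determines it uniquely.\<close>

lemma hurwitz_zeta_eq_hurwitz_cont:
  assumes a: "a > 0" and s: "1 - real k < Re s"
  shows "hurwitz_zeta s a = hurwitz_cont k s a / (s - 1)"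
proof -
  \<comment> \<open>The least level is chosen pointwise only to have a total function:
    \<open>Suc\<close> makes \<open>1 - real k < Re s\<close> strict, and every admissible level
    gives the same value.\<close>
  define E where "E = (\<lambda>s. hurwitz_cont (Suc (nat \<lceil>1 - Re s\<rceil>)) s a)"
  have E_eq: "E s = hurwitz_cont m s a" if "1 - real m < Re s" for s m
  proof -
    let ?l = "Suc (nat \<lceil>1 - Re s\<rceil>)"
    have "1 - real ?l < Re s" by linarith
    then show ?thesis
      using hurwitz_cont_eq[of ?l s "max ?l m" a] hurwitz_cont_eq[of m s "max ?l m" a] that a
      by (simp add: E_def)
  qed
  have "E holomorphic_on (\<Union>m. {s. 1 - real m < Re s})"
  proof (rule holomorphic_on_UN_open)
    show "E holomorphic_on {s. 1 - real m < Re s}" for m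
      by (rule holomorphic_transform[OF hurwitz_cont_holomorphic_on[OF a, of m]]) (simp add: E_eq)
  qed (rule open_halfspace_Re_gt)
  also have "(\<Union>m. {s. 1 - real m < Re s}) = UNIV"
  proof -
    have "\<exists>m. 1 - real m < Re s" for s
      using reals_Archimedean2[of "1 - Re s"] by (metis diff_less_eq add.commute)
    then show ?thesis
      by blast
  qed
  finally have hol: "E holomorphic_on UNIV" .
  \<comment> \<open>At \<open>s = 1\<close> the integral in level 1 has factor 0, leaving
    \<open>a powr 0\<close>. The value is nonzero, so \<open>?Z\<close> has a genuine pole
    there.\<close>
  have "E 1 = 1"
    using a by (simp add: E_eq[of 1])
  let ?Z = "\<lambda>s. E s / (s - 1)"
  have Z: "?Z nicely_meromorphic_on UNIV"
    unfolding nicely_meromorphic_on_def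
  proof (intro conjI ballI)
    have "E analytic_on UNIV"
      using hol by (simp add: analytic_on_open)
    then show "?Z meromorphic_on UNIV"
      by (intro meromorphic_on_divide analytic_on_imp_meromorphic_on analytic_on_diff analytic_on_ident analytic_on_const)
    fix z
    have c: "isCont E z" for z
      using hol holomorphic_on_imp_continuous_on continuous_on_eq_continuous_at open_UNIV by blast
    show "is_pole ?Z z \<and> ?Z z = 0 \<or> ?Z \<midarrow>z\<rightarrow> ?Z z"
    proof (cases "z = 1")
      case True
      have "filterlim (\<lambda>z. z - 1) (at 0) (at (1 :: complex))"
        by (auto simp: filterlim_at eventually_at_filter intro!: tendsto_eq_intros)
      then have "is_pole ?Z 1"
        using \<open>E 1 = 1\<close> by (intro is_pole_divide c) auto
      \<comment> \<open>Division by zero makes \<open>?Z 1 = 0\<close>, which is exactly the value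
        that the normalisation asks for at a pole.\<close>
      then show ?thesis
        using True by simp
    next
      case False
      then show ?thesis
        using c[of z] by (auto simp: isCont_def intro!: tendsto_intros)
    qed
  qed
  have Z_series: "?Z z = (\<Sum>n. (of_nat n + of_real a) powr (- z))" if "Re z > 1" for z
    using E_eq[of 0 z] that by auto
  have "(THE f. f nicely_meromorphic_on UNIV \<and>
      (\<forall>z. Re z > 1 \<longrightarrow> f z = (\<Sum>n. (of_nat n + of_real a) powr (- z)))) = ?Z"
  proof (rule the_equality)
    fix f assume f: "f nicely_meromorphic_on UNIV \<and>
      (\<forall>z. Re z > 1 \<longrightarrow> f z = (\<Sum>n. (of_nat n + of_real a) powr (- z)))"
    show "f = ?Z"
      by (rule nicely_meromorphic_on_UNIV_eqI[OF _ Z open_halfspace_Re_gt[of 1], of _ 2])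
         (use f Z_series in auto)
  qed (use Z Z_series in auto)
  then show ?thesis
    unfolding hurwitz_zeta_def using E_eq[OF s] by simp
qed

section \<open>Continuity of the zeta-function in both variables\<close>

text \<open>Level 1, a single use of the recursion, reaches \<open>Re s > 0\<close> and hence covers
  the strip containing \<open>K\<close>.\<close>

lemma hurwitz_zeta_continuous_on:
  "continuous_on (({s. 0 < Re s} - {1}) \<times> {0<..}) (\<lambda>(s, a). hurwitz_zeta s a)"
proof -
  have "continuous_on (({s. 0 < Re s} - {1}) \<times> {0<..})
      (\<lambda>p. (\<lambda>(s, a). hurwitz_cont 1 s a) p / (fst p - 1))"
    using hurwitz_cont_continuous_on[of 1]
    by (intro continuous_intros continuous_on_subset[OF hurwitz_cont_continuous_on[of 1]]) auto
  then show ?thesis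
    by (rule continuous_on_eq) (auto simp: hurwitz_zeta_eq_hurwitz_cont[of _ 1])
qed

text \<open>Uniform continuity on a compact product; the radius \<open>\<alpha> / 2\<close> keeps
  the second argument away from 0.\<close>

lemma eventually_hurwitz_zeta_close:
  assumes L: "compact L" "L \<subseteq> {s. 0 < Re s} - {1}"
    and \<alpha>: "0 < \<alpha>" and lim: "(\<alpha>s \<longlongrightarrow> \<alpha>) F" and "0 < \<epsilon>"
  shows "\<forall>\<^sub>F n in F. \<forall>s\<in>L. dist (hurwitz_zeta s (\<alpha>s n)) (hurwitz_zeta s \<alpha>) < \<epsilon>"
proof -
  let ?C = "L \<times> cball \<alpha> (\<alpha> / 2)"
  have pos: "a > 0" if "a \<in> cball \<alpha> (\<alpha> / 2)" for a
    using that \<alpha> by (auto simp: dist_real_def abs_if field_simps split: if_splits)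
  have "continuous_on ?C (\<lambda>(s, a). hurwitz_zeta s a)"
    by (rule continuous_on_subset[OF hurwitz_zeta_continuous_on]) (use L pos in auto)
  then have "uniformly_continuous_on ?C (\<lambda>(s, a). hurwitz_zeta s a)"
    by (intro compact_uniformly_continuous compact_Times L compact_cball)
  then obtain d where d: "d > 0"
    "\<And>p q. p \<in> ?C \<Longrightarrow> q \<in> ?C \<Longrightarrow> dist q p < d \<Longrightarrow>
      dist ((\<lambda>(s, a). hurwitz_zeta s a) q) ((\<lambda>(s, a). hurwitz_zeta s a) p) < \<epsilon>"
    using \<open>0 < \<epsilon>\<close> unfolding uniformly_continuous_on_def by metis
  have "\<forall>\<^sub>F n in F. dist (\<alpha>s n) \<alpha> < min d (\<alpha> / 2)"
    using lim d(1) \<alpha> by (intro tendstoD) auto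
  then show ?thesis
  proof eventually_elim
    case (elim n)
    show ?case
    proof
      fix s assume "s \<in> L"
      with elim \<alpha> show "dist (hurwitz_zeta s (\<alpha>s n)) (hurwitz_zeta s \<alpha>) < \<epsilon>"
        using d(2)[of "(s, \<alpha>)" "(s, \<alpha>s n)"] by (auto simp: dist_Pair_Pair dist_commute)
    qed
  qed
qed

text \<open>The supremum is attained, so strictness survives the passage from pointwise bounds to
  \<open>SUP\<close>.\<close>

lemma compact_SUP_less_iff:
  fixes f :: "'a :: topological_space \<Rightarrow> real"
  assumes "compact K" "K \<noteq> {}" "continuous_on K f"
  shows "(SUP s\<in>K. f s) < e \<longleftrightarrow> (\<forall>s\<in>K. f s < e)"
proof -
  obtain m where m: "m \<in> K" "\<And>s. s \<in> K \<Longrightarrow> f s \<le> f m"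
    using continuous_attains_sup[OF assms] by blast
  then have "(SUP s\<in>K. f s) = f m"
    by (intro cSup_eq_maximum) auto
  then show ?thesis
    using m by force
qed

section \<open>Sets of good shifts and their measures\<close>

context
  fixes K :: "complex set" and g :: "complex \<Rightarrow> complex"
  assumes K: "compact K" "K \<subseteq> {s. 1/2 < Re s \<and> Re s < 1}" and g: "continuous_on K g"
begin

lemma continuous_on_shifted_difference:
  assumes "0 < a"
  shows "continuous_on (K \<times> X) (\<lambda>(s, \<tau>). norm (hurwitz_zeta (s + \<i> * of_real \<tau>) a - g s))"
proof -
  have "continuous_on (K \<times> X) (\<lambda>p. (\<lambda>(s, a). hurwitz_zeta s a) (fst p + \<i> * of_real (snd p), a))"
    using K(2) assms
    by (intro continuous_on_compose2[OF hurwitz_zeta_continuous_on])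
       (auto intro!: continuous_intros simp: complex_eq_iff)
  moreover have "continuous_on (K \<times> X) (\<lambda>p. g (fst p))"
    by (rule continuous_on_compose2[OF g]) (auto intro!: continuous_intros)
  ultimately show ?thesis
    by (auto simp: case_prod_beta intro!: continuous_intros)
qed

lemma mem_approx_shifts_iff:
  assumes "0 < a" "K \<noteq> {}"
  shows "\<tau> \<in> approx_shifts K g a \<epsilon> T \<longleftrightarrow>
    \<tau> \<in> {T..2*T} \<and> (\<forall>s\<in>K. norm (hurwitz_zeta (s + \<i> * of_real \<tau>) a - g s) < \<epsilon>)"
proof -
  have "continuous_on K (\<lambda>s. norm (hurwitz_zeta (s + \<i> * of_real \<tau>) a - g s))"
  proof -
    have "continuous_on K (\<lambda>s. (\<lambda>(s, \<tau>). norm (hurwitz_zeta (s + \<i> * of_real \<tau>) a - g s)) (s, \<tau>))"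
      by (rule continuous_on_compose2[OF continuous_on_shifted_difference[OF assms(1), of UNIV]])
         (auto intro!: continuous_intros)
    then show ?thesis
      by simp
  qed
  then show ?thesis
    using compact_SUP_less_iff[OF K(1) assms(2)] by (simp add: approx_shifts_def)
qed

text \<open>For nonempty \<open>K\<close> the bad shifts in \<open>{T..2*T}\<close> are the
  projection of a compact set of pairs \<open>(s, \<tau>)\<close>, hence compact.\<close>

lemma approx_shifts_lmeasurable:
  assumes "0 < a"
  shows "approx_shifts K g a \<epsilon> T \<in> lmeasurable"
proof (cases "K = {}")
  \<comment> \<open>The \<open>SUP\<close> over the empty set is one fixed real, independent of
    \<open>\<tau>\<close>, so either all shifts qualify or none.\<close>
  case True
  then have "approx_shifts K g a \<epsilon> T = {T..2*T} \<or> approx_shifts K g a \<epsilon> T = {}"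
    by (auto simp: approx_shifts_def)
  then show ?thesis
    by auto
next
  case False
  let ?f = "\<lambda>(s, \<tau>). norm (hurwitz_zeta (s + \<i> * of_real \<tau>) a - g s)"
  let ?B = "(K \<times> {T..2*T}) \<inter> ?f -` {\<epsilon>..}"
  have "closed ?B"
    using K(1) by (intro continuous_closed_preimage continuous_on_shifted_difference assms)
      (auto intro!: compact_imp_closed compact_Times)
  then have "compact ((K \<times> {T..2*T}) \<inter> ?B)"
    using K(1) by (intro compact_Int_closed compact_Times) auto
  then have "compact ?B"
    by (simp only: Int_left_absorb)
  then have "compact (snd ` ?B)"
    by (intro compact_continuous_image) (auto intro!: continuous_intros)
  moreover have "approx_shifts K g a \<epsilon> T = {T..2*T} - snd ` ?B"
    using mem_approx_shifts_iff[OF assms False] by (force simp: not_less)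
  ultimately show ?thesis
    by (simp add: fmeasurable_Diff lmeasurable_compact fmeasurableD)
qed

text \<open>For fixed \<open>T\<close> the points \<open>s + \<i> * \<tau>\<close> form a compact
  set that avoids the pole because \<open>Re s < 1\<close> on \<open>K\<close>. There the two
  zeta-functions are eventually \<open>\<epsilon>\<close>-close, and the triangle inequality doubles
  the tolerance.\<close>

lemma eventually_approx_shifts_subset:
  assumes "0 < \<alpha>" "\<alpha>s \<longlonglongrightarrow> \<alpha>" "\<And>n. 0 < \<alpha>s n" "0 < \<epsilon>"
  shows "\<forall>\<^sub>F n in sequentially. approx_shifts K g (\<alpha>s n) \<epsilon> T \<subseteq> approx_shifts K g \<alpha> (2 * \<epsilon>) T"
proof (cases "K = {}")
  case True
  then show ?thesis
    using \<open>0 < \<epsilon>\<close> by (auto simp: approx_shifts_def)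
next
  case False
  let ?L = "(\<lambda>(s, \<tau>). s + \<i> * of_real \<tau>) ` (K \<times> {T..2*T})"
  have "compact ?L"
    using K(1) by (intro compact_continuous_image compact_Times)
      (auto simp: case_prod_beta intro!: continuous_intros)
  moreover have "?L \<subseteq> {s. 0 < Re s} - {1}"
    using K(2) by (auto simp: complex_eq_iff)
  ultimately have "\<forall>\<^sub>F n in sequentially. \<forall>z\<in>?L. dist (hurwitz_zeta z (\<alpha>s n)) (hurwitz_zeta z \<alpha>) < \<epsilon>"
    using assms by (intro eventually_hurwitz_zeta_close)
  then show ?thesis
  proof eventually_elim
    case (elim n)
    show ?case
    proof
      fix \<tau> assume \<tau>: "\<tau> \<in> approx_shifts K g (\<alpha>s n) \<epsilon> T"
      have "norm (hurwitz_zeta (s + \<i> * of_real \<tau>) \<alpha> - g s) < 2 * \<epsilon>" if "s \<in> K" for s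
      proof -
        have "dist (hurwitz_zeta (s + \<i> * of_real \<tau>) (\<alpha>s n)) (g s) < \<epsilon>"
          "dist (hurwitz_zeta (s + \<i> * of_real \<tau>) (\<alpha>s n)) (hurwitz_zeta (s + \<i> * of_real \<tau>) \<alpha>) < \<epsilon>"
          using \<tau> elim that unfolding mem_approx_shifts_iff[OF assms(3) False] by (auto simp: dist_norm)
        then have "dist (hurwitz_zeta (s + \<i> * of_real \<tau>) \<alpha>) (g s) < \<epsilon> + \<epsilon>"
          by (intro dist_triangle_less_add[of _ "hurwitz_zeta (s + \<i> * of_real \<tau>) (\<alpha>s n)"])
             (auto simp: dist_commute)
        then show ?thesis
          by (simp add: dist_norm)
      qed
      with \<tau> show "\<tau> \<in> approx_shifts K g \<alpha> (2 * \<epsilon>) T"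
        using mem_approx_shifts_iff[OF assms(1) False] mem_approx_shifts_iff[OF assms(3) False] by blast
    qed
  qed
qed

text \<open>An upper limit sees only large \<open>n\<close>, so the threshold in the inclusion of
  sets may depend on \<open>T\<close>.\<close>

lemma limsup_measure_approx_shifts_le:
  assumes "0 < \<alpha>" "\<alpha>s \<longlonglongrightarrow> \<alpha>" "\<And>n. 0 < \<alpha>s n" "0 < \<epsilon>" "0 < T"
  shows "limsup (\<lambda>n. ereal (1 / T * measure lebesgue (approx_shifts K g (\<alpha>s n) \<epsilon> T)))
    \<le> ereal (1 / T * measure lebesgue (approx_shifts K g \<alpha> (2 * \<epsilon>) T))"
proof (rule Limsup_bounded)
  show "\<forall>\<^sub>F n in sequentially. ereal (1 / T * measure lebesgue (approx_shifts K g (\<alpha>s n) \<epsilon> T))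
    \<le> ereal (1 / T * measure lebesgue (approx_shifts K g \<alpha> (2 * \<epsilon>) T))"
    using eventually_approx_shifts_subset[OF assms(1-4), of T]
  proof eventually_elim
    case (elim n)
    then have "measure lebesgue (approx_shifts K g (\<alpha>s n) \<epsilon> T)
        \<le> measure lebesgue (approx_shifts K g \<alpha> (2 * \<epsilon>) T)"
      using approx_shifts_lmeasurable assms by (intro measure_mono_fmeasurable) (auto intro: fmeasurableD)
    then show ?case
      using \<open>0 < T\<close> by (simp add: divide_right_mono)
  qed
qed

end

theorem theorem6p5:
  fixes K :: "complex set" and g :: "complex \<Rightarrow> complex"
    and \<alpha> :: real and \<alpha>s :: "nat \<Rightarrow> real" and c :: "real \<Rightarrow> real"
  assumes "compact K" and "K \<subseteq> {s. 1/2 < Re s \<and> Re s < 1}" and "connected (- K)"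
    and "continuous_on K g" and "g analytic_on interior K"
    and "0 < \<alpha>" and "\<alpha> < 1" and "algebraic \<alpha>" and "\<alpha> \<notin> \<rat>"
    and "\<And>n. \<alpha>s n \<in> {0<..1} \<inter> \<rat>" and "\<alpha>s \<longlonglongrightarrow> \<alpha>"
    and "\<forall>\<^sub>F \<epsilon> in at_right 0.
           Liminf at_top (\<lambda>T::real. limsup (\<lambda>n.
             ereal (1 / T * measure lebesgue (approx_shifts K g (\<alpha>s n) \<epsilon> T)))) \<ge> ereal (c \<epsilon>)
           \<and> c \<epsilon> > 0"
  shows "\<forall>\<^sub>F \<epsilon> in at_right 0.
           Liminf at_top (\<lambda>T::real.
             ereal (1 / T * measure lebesgue (approx_shifts K g \<alpha> \<epsilon> T))) > 0"
proof -
  have \<alpha>s_pos: "0 < \<alpha>s n" for n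
    using assms(10)[of n] by auto
  obtain b where b: "b > 0" and hyp: "\<And>\<epsilon>. 0 < \<epsilon> \<Longrightarrow> \<epsilon> < b \<Longrightarrow>
      Liminf at_top (\<lambda>T::real. limsup (\<lambda>n.
        ereal (1 / T * measure lebesgue (approx_shifts K g (\<alpha>s n) \<epsilon> T)))) \<ge> ereal (c \<epsilon>) \<and> c \<epsilon> > 0"
    using assms(12) unfolding eventually_at_right_field by blast
  have "Liminf at_top (\<lambda>T::real. ereal (1 / T * measure lebesgue (approx_shifts K g \<alpha> \<epsilon> T))) > 0"
    \<comment> \<open>The range is \<open>2 * b\<close> because the hypothesis is applied at
      \<open>\<epsilon> / 2\<close>, to absorb the doubled tolerance.\<close>
    if \<epsilon>: "0 < \<epsilon>" "\<epsilon> < 2 * b" for \<epsilon>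
  proof -
    have "0 < ereal (c (\<epsilon> / 2))"
      using hyp[of "\<epsilon> / 2"] \<epsilon> by simp
    also have "\<dots> \<le> Liminf at_top (\<lambda>T::real. limsup (\<lambda>n.
        ereal (1 / T * measure lebesgue (approx_shifts K g (\<alpha>s n) (\<epsilon> / 2) T))))"
      using hyp[of "\<epsilon> / 2"] \<epsilon> by simp
    also have "\<dots> \<le> Liminf at_top (\<lambda>T::real.
        ereal (1 / T * measure lebesgue (approx_shifts K g \<alpha> \<epsilon> T)))"
    proof (rule Liminf_mono)
      show "\<forall>\<^sub>F T in at_top. limsup (\<lambda>n. ereal (1 / T * measure lebesgue (approx_shifts K g (\<alpha>s n) (\<epsilon> / 2) T)))
          \<le> ereal (1 / T * measure lebesgue (approx_shifts K g \<alpha> \<epsilon> T))"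
        using eventually_gt_at_top[of 0]
      proof eventually_elim
        case (elim T)
        then show ?case
          using limsup_measure_approx_shifts_le[OF assms(1,2,4,6,11) \<alpha>s_pos, of "\<epsilon> / 2" T] \<epsilon> by simp
      qed
    qed
    finally show ?thesis .
  qed
  then show ?thesis
    unfolding eventually_at_right_field using b by (intro exI[of _ "2 * b"]) auto
qed

end
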